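(* Let $q$ be a prime power, let $d$ be an integer with $2<d<q-1$, and let $f=x^d\in\mathbb{F}_q[x]$. Then $\deg(S_f)\le\min(d,q-d+1)$. More specifically, for $a,b\in\mathbb{F}_q$, the number of $x\in\mathbb{F}_q$ with $x^d=ax+b$ is at most (i) $q-d+1$ if $a\neq0$ and $b=0$; (ii) $q-d$ if $a\neq 0$ and $b\neq 0$; (iii) $q-d-1$ if $a=0$ and $b\neq 0$.
   Context: $\mathrm{PG}(2,q)$ is the projective plane over $\mathbb{F}_q$. For $f\in\mathbb{F}_q[x]$, $S_f=\{(x,f(x),1):x\in\mathbb{F}_q\}\cup\{(0,1,0)\}$. For a set $D$ of $q+1$ points, $u_i(D)$ is the number of lines of $\mathrm{PG}(2,q)$ containing exactly $i$ points of $D$, and the degree $\deg(D)$ is the largest $i$ with $u_i(D)\neq 0$. *)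

theory Defs
  imports "HOL-Analysis.Analysis" "HOL-Computational_Algebra.Polynomial"
begin

text \<open>
  The plane \<open>PG(2,q)\<close> is the lattice of subspaces of \<open>F\<^sub>q\<^sup>3\<close>: its points and lines are the
  subspaces of dimension 1 and 2, and incidence is inclusion.
\<close>

definition pg_points :: "('a::field ^ 3) set set" where
  "pg_points = {P. vec.subspace P \<and> vec.dim P = 1}"

definition pg_lines :: "('a::field ^ 3) set set" where
  "pg_lines = {L. vec.subspace L \<and> vec.dim L = 2}"

definition pg_point :: "'a::field \<Rightarrow> 'a \<Rightarrow> 'a \<Rightarrow> ('a ^ 3) set" where
  "pg_point x y z = vec.span {vector [x, y, z]}"

definition graph_set :: "'a::field poly \<Rightarrow> ('a ^ 3) set set" where
  "graph_set f = {pg_point x (poly f x) 1 | x. True} \<union> {pg_point 0 1 0}"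

definition num_secants :: "nat \<Rightarrow> ('a::field ^ 3) set set \<Rightarrow> nat" where
  "num_secants i D = card {L \<in> pg_lines. card {P \<in> D. P \<subseteq> L} = i}"

definition secant_degree :: "('a::field ^ 3) set set \<Rightarrow> nat" where
  "secant_degree D = Max {i. num_secants i D \<noteq> 0}"

text \<open>Over a finite field, the maximum in \<^const>\<open>secant_degree\<close> is over a finite nonempty set.\<close>

lemma finite_num_secants_nonzero:
  fixes D :: "('a::{field,finite} ^ 3) set set"
  shows "finite {i. num_secants i D \<noteq> 0}"
proof (rule finite_subset)
  show "{i. num_secants i D \<noteq> 0} \<subseteq> (\<lambda>L. card {P \<in> D. P \<subseteq> L}) ` pg_lines"
  proof
    fix i assume "i \<in> {i. num_secants i D \<noteq> 0}"
    then have "{L \<in> pg_lines. card {P \<in> D. P \<subseteq> L} = i} \<noteq> {}"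
      unfolding num_secants_def by (auto simp del: Collect_empty_eq)
    then show "i \<in> (\<lambda>L. card {P \<in> D. P \<subseteq> L}) ` pg_lines" by auto
  qed
qed simp

lemma pg_lines_nonempty: "(pg_lines :: ('a::field ^ 3) set set) \<noteq> {}"
proof -
  have "2 \<le> vec.dim (UNIV :: ('a ^ 3) set)"
    by (simp add: vec.dimension_def vec.dim_UNIV card_cart_basis)
  then obtain L :: "('a ^ 3) set" where "vec.subspace L" "vec.dim L = 2"
    using vec.choose_subspace_of_subspace by metis
  then show ?thesis unfolding pg_lines_def by blast
qed

lemma num_secants_nonzero_exists:
  fixes D :: "('a::{field,finite} ^ 3) set set"
  shows "{i. num_secants i D \<noteq> 0} \<noteq> {}"
proof -
  obtain L :: "('a ^ 3) set" where "L \<in> pg_lines"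
    using pg_lines_nonempty by auto
  then have "num_secants (card {P \<in> D. P \<subseteq> L}) D \<noteq> 0"
    unfolding num_secants_def by auto
  then show ?thesis by blast
qed

lemma pg_point_in_points:
  assumes "x \<noteq> 0 \<or> y \<noteq> 0 \<or> z \<noteq> 0"
  shows "pg_point x y z \<in> pg_points"
proof -
  have "vector [x, y, z] \<noteq> (0 :: 'a::field ^ 3)"
    using assms by (auto simp: vec_eq_iff forall_3)
  then show ?thesis
    unfolding pg_points_def pg_point_def by (simp add: vec.dim_singleton)
qed

lemma graph_set_subset_points: "graph_set f \<subseteq> pg_points"
  unfolding graph_set_def by (auto intro!: pg_point_in_points)

lemma card_graph_set:
  fixes f :: "'a::{field,finite} poly"
  shows "card (graph_set f) = CARD('a) + 1"
proof -
  let ?g = "\<lambda>x. pg_point x (poly f x) 1"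
  have inj: "inj ?g"
  proof (rule injI)
    fix x y assume "?g x = ?g y"
    then have "vector [x, poly f x, 1] \<in> vec.span {vector [y, poly f y, 1] :: 'a ^ 3}"
      unfolding pg_point_def using vec.span_base by blast
    then obtain c where "vector [x, poly f x, 1] = c *s (vector [y, poly f y, 1] :: 'a ^ 3)"
      by (auto simp: vec.span_singleton)
    then show "x = y" by (auto simp: vec_eq_iff forall_3)
  qed
  have notin: "pg_point 0 1 0 \<notin> range ?g"
  proof
    assume "pg_point 0 1 0 \<in> range ?g"
    then obtain x where "pg_point 0 1 0 = ?g x" by blast
    then have "vector [x, poly f x, 1] \<in> vec.span {vector [0, 1, 0] :: 'a ^ 3}"
      unfolding pg_point_def using vec.span_base by blast
    then show False by (auto simp: vec.span_singleton vec_eq_iff forall_3)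
  qed
  have "graph_set f = insert (pg_point 0 1 0) (range ?g)"
    unfolding graph_set_def by auto
  then show ?thesis using inj notin by (simp add: card_image)
qed

end

theory Submission
  imports Defs
begin

text \<open>
  A nonzero solution of \<open>x\<^sup>d = a x + b\<close> satisfies \<open>x\<^sup>q\<^sup>-\<^sup>1 = 1\<close>; multiplying the
  equation by \<open>x\<^sup>q\<^sup>-\<^sup>1\<^sup>-\<^sup>d\<close> shows that it is a root of \<open>a X\<^sup>q\<^sup>-\<^sup>d + b X\<^sup>q\<^sup>-\<^sup>1\<^sup>-\<^sup>d - 1\<close>,
  a polynomial with constant term \<open>-1\<close> whose degree gives the three bounds.
  A line through \<open>(0,1,0)\<close> contains at most one further point of \<open>S\<^sub>f\<close>, and a line missing
  \<open>(0,1,0)\<close> meets \<open>S\<^sub>f\<close> in the points with \<open>f(x) = a x + b\<close> for suitable \<open>a\<close> and \<open>b\<close>.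
\<close>

section \<open>Solutions of \<open>x ^ d = a * x + b\<close> over a finite field\<close>

lemma finite_field_power_card_minus_1:
  fixes x :: "'a::{field,finite}"
  assumes "x \<noteq> 0"
  shows "x ^ (CARD('a) - 1) = 1"
proof -
  have bij: "bij_betw ((*) x) (- {0}) (- {0})"
    by (rule bij_betw_byWitness[where f' = "(*) (inverse x)"]) (use assms in auto)
  \<comment> \<open>Multiplication by \<open>x\<close> permutes the nonzero elements, so pulling
    \<open>x\<close> out of each factor leaves their product unchanged; that product is nonzero and
    cancels.\<close>
  have "(\<Prod>y\<in>- {0}. y) = (\<Prod>y\<in>- {0}. x * y)"
    by (rule prod.reindex_bij_betw[OF bij, symmetric])
  also have "\<dots> = x ^ card (- {0 :: 'a}) * (\<Prod>y\<in>- {0}. y)"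
    by (simp add: prod.distrib)
  finally have "x ^ card (- {0 :: 'a}) = 1"
    by simp
  then show ?thesis
    by (simp add: Compl_eq_Diff_UNIV card_Diff_subset)
qed

lemma card_subset_roots_le_degree:
  fixes p :: "'a::idom poly"
  assumes "p \<noteq> 0" and "degree p \<le> n" and "\<And>x. x \<in> S \<Longrightarrow> poly p x = 0"
  shows "card S \<le> n"
proof -
  have "card S \<le> card {x. poly p x = 0}"
    by (rule card_mono) (use assms poly_roots_finite in auto)
  also have "\<dots> \<le> n"
    using card_poly_roots_bound[OF assms(1)] assms(2) by linarith
  finally show ?thesis .
qed

lemma card_power_eq_affine_le:
  fixes a b :: "'a::idom"
  assumes "2 \<le> d"
  shows "card {x. x ^ d = a * x + b} \<le> d"
proof (rule card_subset_roots_le_degree)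
  let ?p = "monom 1 d - [:b, a:]"
  \<comment> \<open>Since \<open>2 \<le> d\<close>, the affine part cannot touch the leading
    coefficient.\<close>
  have "coeff ?p d = 1"
    using assms by (simp add: coeff_pCons split: nat.split)
  then show "?p \<noteq> 0" by (metis coeff_0 zero_neq_one)
  show "degree ?p \<le> d"
    using assms by (intro degree_diff_le) (auto simp: degree_monom_eq)
  show "poly ?p x = 0" if "x \<in> {x. x ^ d = a * x + b}" for x
    using that by (simp add: poly_monom algebra_simps)
qed

text \<open>The bound \<open>n\<close> is left free and its second condition is conditional on
  \<open>a \<noteq> 0\<close>, so that one statement covers both degrees the auxiliary polynomial
  can have.\<close>

lemma card_nonzero_power_eq_affine_le:
  fixes a b :: "'a::{field,finite}"
  assumes "d < CARD('a) - 1"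
    and "CARD('a) - 1 - d \<le> n" and "a \<noteq> 0 \<Longrightarrow> CARD('a) - d \<le> n"
  shows "card {x. x \<noteq> 0 \<and> x ^ d = a * x + b} \<le> n"
proof (rule card_subset_roots_le_degree)
  define m where "m = CARD('a) - 1 - d"
  have m: "0 < m" "d + m = CARD('a) - 1" "CARD('a) - d = Suc m"
    using assms(1) by (auto simp: m_def)
  let ?p = "monom a (Suc m) + monom b m - 1"
  \<comment> \<open>As \<open>0 < m\<close>, both monomials vanish at 0; hence \<open>?p\<close> is
    nonzero even when \<open>a = b = 0\<close>.\<close>
  have "coeff ?p 0 = - 1"
    using m(1) by simp
  then show "?p \<noteq> 0" by (metis coeff_0 neg_equal_0_iff_equal zero_neq_one)
  have "degree (monom a (Suc m)) \<le> n"
    using assms(3) m(3) by (cases "a = 0") (auto simp: degree_monom_eq)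
  moreover have "degree (monom b m) \<le> n"
    using assms(2) degree_monom_le[of b m] by (simp add: m_def)
  ultimately show "degree ?p \<le> n"
    by (intro degree_diff_le degree_add_le) auto
  show "poly ?p x = 0" if "x \<in> {x. x \<noteq> 0 \<and> x ^ d = a * x + b}" for x
  proof -
    have "1 = x ^ d * x ^ m"
      using that finite_field_power_card_minus_1[of x] by (metis (lifting) m(2) mem_Collect_eq power_add)
    also have "\<dots> = (a * x + b) * x ^ m"
      using that by simp
    finally show ?thesis
      by (simp add: poly_monom algebra_simps)
  qed
qed

lemma card_power_eq_affine_le_if_b_nonzero:
  fixes a b :: "'a::{field,finite}"
  assumes "0 < d" and "d < CARD('a) - 1" and "b \<noteq> 0"
    and "CARD('a) - 1 - d \<le> n" and "a \<noteq> 0 \<Longrightarrow> CARD('a) - d \<le> n"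
  shows "card {x. x ^ d = a * x + b} \<le> n"
proof -
  have "{x. x ^ d = a * x + b} = {x. x \<noteq> 0 \<and> x ^ d = a * x + b}"
    using assms(1,3) by (auto simp: power_0_left)
  then show ?thesis
    using card_nonzero_power_eq_affine_le[of d n a b] assms by simp
qed

text \<open>The extra 1 allows for the solution 0. The bound is uniform in \<open>a\<close> and
  \<open>b\<close>, as the degree estimate requires.\<close>

lemma card_power_eq_affine_le_complement:
  fixes a b :: "'a::{field,finite}"
  assumes "d < CARD('a) - 1"
  shows "card {x. x ^ d = a * x + b} \<le> CARD('a) - d + 1"
proof -
  let ?N = "{x. x \<noteq> 0 \<and> x ^ d = a * x + b}"
  have "card {x. x ^ d = a * x + b} \<le> card (insert 0 ?N)"
    by (rule card_mono) auto
  also have "\<dots> \<le> card ?N + 1"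
    by simp
  also have "card ?N \<le> CARD('a) - d"
    by (rule card_nonzero_power_eq_affine_le) (use assms in auto)
  finally show ?thesis by simp
qed

section \<open>Lines of the plane and the points of \<open>graph_set f\<close> on them\<close>

lemma pg_point_subset_iff:
  assumes "vec.subspace L"
  shows "pg_point x y z \<subseteq> L \<longleftrightarrow> vector [x, y, z] \<in> L"
  unfolding pg_point_def using assms vec.span_base vec.span_minimal by blast

lemma line_off_vertical_point:
  fixes g :: "'a::field \<Rightarrow> 'a"
  assumes L: "vec.subspace L" and off: "vector [0, 1, 0] \<notin> (L :: ('a ^ 3) set)"
  obtains a b where "\<And>x. vector [x, g x, 1] \<in> L \<Longrightarrow> g x = a * x + b"
proof (cases "\<exists>x y. x \<noteq> y \<and> vector [x, g x, 1] \<in> L \<and> vector [y, g y, 1] \<in> L")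
  case True
  then obtain x y where xy: "x \<noteq> y" "vector [x, g x, 1] \<in> L" "vector [y, g y, 1] \<in> L"
    by blast
  define a where "a = (g y - g x) / (y - x)"
  have a: "a * (y - x) = g y - g x"
    using xy(1) by (simp add: a_def)
  have "g z = a * z + (g x - a * x)" if z: "vector [z, g z, 1] \<in> L" for z
  proof (rule ccontr)
    assume neq: "g z \<noteq> a * z + (g x - a * x)"
    \<comment> \<open>The weights \<open>1 - t\<close> and \<open>t\<close> on the two known points
      reproduce the first and third coordinates of the new one, so the difference is
      \<open>c\<close> times the vertical vector, which would put that vector in
      \<open>L\<close>.\<close>
    define t where "t = (z - x) / (y - x)"
    define c where "c = g z - (a * z + (g x - a * x))"
    have t: "t * (y - x) = z - x"
      using xy(1) by (simp add: t_def)
    have zt: "z = (1 - t) * x + t * y"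
      using t by (simp add: algebra_simps)
    have gt: "(1 - t) * g x + t * g y = a * z + (g x - a * x)"
    proof -
      have "t * (g y - g x) = a * (z - x)"
        using a t by (metis mult.assoc mult.commute)
      then show ?thesis by (simp add: algebra_simps)
    qed
    let ?v = "vector [z, g z, 1] -
      ((1 - t) *s vector [x, g x, 1] + t *s vector [y, g y, 1]) :: 'a ^ 3"
    have "?v \<in> L"
      using xy z L by (intro vec.subspace_scale vec.subspace_diff vec.subspace_add) auto
    also have "?v = c *s vector [0, 1, 0]"
    proof -
      have "z - ((1 - t) * x + t * y) = 0"
        using zt by simp
      moreover have "g z - ((1 - t) * g x + t * g y) = c"
        by (simp only: gt c_def)
      ultimately show ?thesis
        by (simp add: vec_eq_iff forall_3 algebra_simps)
    qed
    finally have "inverse c *s (c *s vector [0, 1, 0]) \<in> L"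
      by (rule vec.subspace_scale[OF L])
    moreover have "c \<noteq> 0"
      using neq by (simp add: c_def)
    ultimately show False
      using off by simp
  qed
  then show ?thesis
    using that by blast
next
  case False
  \<comment> \<open>At most one graph point lies in \<open>L\<close>: slope 0 through it works, and
    without such a point any \<open>a\<close> and \<open>b\<close> do.\<close>
  show ?thesis
  proof (cases "\<exists>x. vector [x, g x, 1] \<in> L")
    case True
    then obtain x where "vector [x, g x, 1] \<in> L" by blast
    then have "g y = 0 * y + g x" if "vector [y, g y, 1] \<in> L" for y
      using False that by fastforce
    then show ?thesis using that by blast
  qed (use that in blast)
qed

text \<open>For \<open>x \<noteq> y\<close> the three vectors would span the whole space, which has
  dimension 3.\<close>

lemma line_through_vertical_point:
  fixes L :: "('a::field ^ 3) set"
  assumes "L \<in> pg_lines" and "vector [0, 1, 0] \<in> L"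
    and "vector [x, u, 1] \<in> L" and "vector [y, v, 1] \<in> L"
  shows "x = y"
proof (rule ccontr)
  assume neq: "x \<noteq> y"
  have L: "vec.subspace L" "vec.dim L = 2"
    using assms(1) by (auto simp: pg_lines_def)
  have "w \<in> L" for w :: "'a ^ 3"
  proof -
    \<comment> \<open>The weights \<open>w $ 3 - t\<close> and \<open>t\<close> fix the third
      coordinate; \<open>t\<close> is solved from the first, and the vertical vector then corrects
      the second.\<close>
    define t where "t = (w $ 1 - w $ 3 * x) / (y - x)"
    have t: "t * y = t * x + (w $ 1 - w $ 3 * x)"
      using neq by (simp add: t_def field_simps)
    let ?w = "(w $ 3 - t) *s vector [x, u, 1] + t *s vector [y, v, 1] +
      (w $ 2 - (w $ 3 - t) * u - t * v) *s vector [0, 1, 0] :: 'a ^ 3"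
    have "?w \<in> L"
      using assms L by (intro vec.subspace_scale vec.subspace_add) auto
    moreover have "?w = w"
      using t by (simp add: vec_eq_iff forall_3 algebra_simps)
    ultimately show ?thesis by simp
  qed
  then have "L = UNIV" by blast
  then show False
    using L(2) by (simp add: vec.dimension_def vec.dim_UNIV card_cart_basis)
qed

text \<open>The condition \<open>2 \<le> n\<close> takes care of the lines through the vertical
  point; every other line is controlled by \<open>affine\<close>.\<close>

lemma card_graph_set_inter_line_le:
  fixes f :: "'a::{field,finite} poly"
  assumes L: "L \<in> pg_lines" and "2 \<le> n"
    and affine: "\<And>a b. card {x. poly f x = a * x + b} \<le> n"
  shows "card {P \<in> graph_set f. P \<subseteq> L} \<le> n"
proof -
  let ?g = "\<lambda>x. pg_point x (poly f x) 1"
  have sub: "vec.subspace L"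
    using L by (simp add: pg_lines_def)
  define X where "X = {x. vector [x, poly f x, 1] \<in> L}"
  show ?thesis
  proof (cases "vector [0, 1, 0] \<in> L")
    case True
    have "{P \<in> graph_set f. P \<subseteq> L} \<subseteq> insert (pg_point 0 1 0) (?g ` X)"
      by (auto simp: graph_set_def X_def pg_point_subset_iff[OF sub])
    then have "card {P \<in> graph_set f. P \<subseteq> L} \<le> card (insert (pg_point 0 1 0) (?g ` X))"
      by (intro card_mono) auto
    also have "\<dots> \<le> Suc (card (?g ` X))"
      by (rule card_insert_le_m1) auto
    also have "card (?g ` X) \<le> card X"
      by (rule card_image_le) simp
    also have "card X \<le> 1"
      using line_through_vertical_point[OF L True] by (auto simp: card_le_Suc0_iff_eq X_def)
    finally show ?thesis
      using assms(2) by simp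
  next
    case False
    then obtain a b where ab: "\<And>x. vector [x, poly f x, 1] \<in> L \<Longrightarrow> poly f x = a * x + b"
      using line_off_vertical_point[OF sub, of "poly f"] by blast
    have "{P \<in> graph_set f. P \<subseteq> L} \<subseteq> ?g ` X"
      using False by (auto simp: graph_set_def X_def pg_point_subset_iff[OF sub])
    also have "\<dots> \<subseteq> ?g ` {x. poly f x = a * x + b}"
      using ab by (intro image_mono) (auto simp: X_def)
    finally have "{P \<in> graph_set f. P \<subseteq> L} \<subseteq> ?g ` {x. poly f x = a * x + b}" .
    then have "card {P \<in> graph_set f. P \<subseteq> L} \<le> card (?g ` {x. poly f x = a * x + b})"
      by (intro card_mono) auto
    also have "\<dots> \<le> card {x. poly f x = a * x + b}"
      by (rule card_image_le) simp
    also have "\<dots> \<le> n"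
      by (rule affine)
    finally show ?thesis .
  qed
qed

lemma secant_degree_le:
  fixes D :: "('a::{field,finite} ^ 3) set set"
  assumes "\<And>L. L \<in> pg_lines \<Longrightarrow> card {P \<in> D. P \<subseteq> L} \<le> n"
  shows "secant_degree D \<le> n"
  unfolding secant_degree_def
proof (rule Max.boundedI[OF finite_num_secants_nonzero num_secants_nonzero_exists])
  fix i assume "i \<in> {i. num_secants i D \<noteq> 0}"
  then have "{L \<in> pg_lines. card {P \<in> D. P \<subseteq> L} = i} \<noteq> {}"
    unfolding num_secants_def by (auto simp del: Collect_empty_eq)
  then show "i \<le> n"
    using assms by blast
qed

theorem theorem3p2:
  fixes q d :: nat and f :: "'a::{field,finite} poly"
  assumes "q = CARD('a)"
    and "2 < d" and "d < q - 1"
    and "f = monom 1 d"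
  shows "secant_degree (graph_set f) \<le> min d (q - d + 1) \<and>
    (\<forall>a b :: 'a.
      (a \<noteq> 0 \<and> b = 0 \<longrightarrow> card {x :: 'a. x ^ d = a * x + b} \<le> q - d + 1) \<and>
      (a \<noteq> 0 \<and> b \<noteq> 0 \<longrightarrow> card {x :: 'a. x ^ d = a * x + b} \<le> q - d) \<and>
      (a = 0 \<and> b \<noteq> 0 \<longrightarrow> card {x :: 'a. x ^ d = a * x + b} \<le> q - d - 1))"
proof (intro conjI allI impI)
  have d: "d < CARD('a) - 1" "0 < d"
    using assms by auto
  show "secant_degree (graph_set f) \<le> min d (q - d + 1)"
  proof (intro secant_degree_le card_graph_set_inter_line_le)
    show "2 \<le> min d (q - d + 1)"
      using assms by auto
    show "card {x. poly f x = a * x + b} \<le> min d (q - d + 1)" for a b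
      using card_power_eq_affine_le[of d a b] card_power_eq_affine_le_complement[OF d(1), of a b]
        assms by (simp add: poly_monom)
  qed
  fix a b :: 'a
  show "card {x. x ^ d = a * x + b} \<le> q - d + 1"
    using card_power_eq_affine_le_complement[OF d(1)] assms(1) by simp
  show "card {x. x ^ d = a * x + b} \<le> q - d" if "a \<noteq> 0 \<and> b \<noteq> 0"
    using that d assms(1) by (intro card_power_eq_affine_le_if_b_nonzero) auto
  \<comment> \<open>With \<open>a = 0\<close> the conditional requirement on \<open>n\<close> is
    vacuous, which permits the smaller bound.\<close>
  show "card {x. x ^ d = a * x + b} \<le> q - d - 1" if "a = 0 \<and> b \<noteq> 0"
    using that d assms(1) by (intro card_power_eq_affine_le_if_b_nonzero) auto
qed

end
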